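(* Let $q\ge 1$ be an integer, let $T$ be an infinite $(q+1)$-homogeneous tree rooted at $o$, and let $0<p\le\infty$. Convergence in $\|\cdot\|_p$ implies uniform convergence on compact subsets of $T$: if $f, f_n\in\mathbb{T}_p$ ($n\in\mathbb{N}$) and $\|f_n-f\|_p\to0$ as $n\to\infty$, then $\sup_{v\in K}|f_n(v)-f(v)|\to0$ as $n\to\infty$ for every compact set $K\subset T$.
   Context: A $(q+1)$-homogeneous tree is a connected graph without cycles in which every vertex has exactly $q+1$ neighbours; rooted means that a vertex $o$ (the root) is singled out. The set of vertices of $T$ (also denoted $T$) carries the edge-counting distance (number of edges in the unique path between two vertices), and compactness is with respect to it. For a vertex $v$, $|v|$ is the distance from $o$ to $v$; for $n\ge1$ there are $(q+1)q^{n-1}$ vertices with $|v|=n$. Functions on $T$ are functions on its vertices. $\mathbb{N}=\{1,2,\dots\}$, $\mathbb{N}_0=\mathbb{N}\cup\{0\}$. For $f\colon T\to\mathbb{C}$ and $n\in\mathbb{N}$, $M_p(n,f)=\left(\frac{1}{(q+1)q^{n-1}}\sum_{|v|=n}|f(v)|^p\right)^{1/p}$ if $0<p<\infty$, $M_\infty(n,f)=\max_{|v|=n}|f(v)|$, and $M_p(0,f)=|f(o)|$ for all $p\in(0,\infty]$. Put $\|f\|_p=\sup_{n\in\mathbb{N}_0}M_p(n,f)$ and $\mathbb{T}_p=\{f\colon T\to\mathbb{C}:\|f\|_p<\infty\}$. *)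

theory Defs
  imports "HOL-Analysis.Analysis" "Graph_Theory.Graph_Theory"
begin

text \<open>
  Undirected simple graphs, possibly infinite, are represented as symmetric digraphs without
  loops and multiple arcs; the library locale \<open>graph\<close> cannot be used because it requires
  finiteness.
\<close>

definition simple_graph :: "('a, 'b) pre_digraph \<Rightarrow> bool" where
  "simple_graph T \<longleftrightarrow> sym_digraph T \<and> loopfree_digraph T \<and> nomulti_digraph T"

text \<open>
  The library predicate \<open>tree\<close> is not suitable for symmetric digraphs: it regards the closed walk
  \<open>u, v, u\<close> along an edge and back as a cycle. In a simple graph represented as above, the cycles
  in the undirected sense are the library cycles with at least three arcs.
\<close>

definition undirected_tree :: "('a, 'b) pre_digraph \<Rightarrow> bool" where
  "undirected_tree T \<longleftrightarrow>
     simple_graph T \<and> Digraph_Component.connected T \<and>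
     \<not> (\<exists>c. pre_digraph.cycle T c \<and> 3 \<le> length c)"

text \<open>As \<open>card\<close> is 0 on infinite sets, this forces every vertex to have finitely many neighbours.\<close>

definition homogeneous_tree :: "nat \<Rightarrow> ('a, 'b) pre_digraph \<Rightarrow> bool" where
  "homogeneous_tree q T \<longleftrightarrow>
     undirected_tree T \<and> (\<forall>v \<in> verts T. card {w. v \<rightarrow>\<^bsub>T\<^esub> w} = q + 1)"

definition tree_dist :: "('a, 'b) pre_digraph \<Rightarrow> 'a \<Rightarrow> 'a \<Rightarrow> nat" where
  "tree_dist T u v = length (THE p. pre_digraph.apath T u p v)"

definition tree_topology :: "('a, 'b) pre_digraph \<Rightarrow> 'a topology" where
  "tree_topology T = Metric_space.mtopology (verts T) (\<lambda>u v. real (tree_dist T u v))"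

definition tree_sphere :: "('a, 'b) pre_digraph \<Rightarrow> 'a \<Rightarrow> nat \<Rightarrow> 'a set" where
  "tree_sphere T r n = {v \<in> verts T. tree_dist T r v = n}"

text \<open>
  In the following, \<open>r\<close> is the root of \<open>T\<close>, and the exponent \<open>p > 0\<close> is an extended nonnegative
  real. Functions on \<open>T\<close> are total on the vertex type, but only
  their values on \<open>verts T\<close> are used.
\<close>

definition tree_mean ::
  "nat \<Rightarrow> ('a, 'b) pre_digraph \<Rightarrow> 'a \<Rightarrow> ennreal \<Rightarrow> nat \<Rightarrow> ('a \<Rightarrow> complex) \<Rightarrow> real" where
  "tree_mean q T r p n f =
     (if n = 0 then cmod (f r)
      else if p = \<infinity> then Max ((\<lambda>v. cmod (f v)) ` tree_sphere T r n)
      else (1 / ((real q + 1) * real q ^ (n - 1)) *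
              (\<Sum>v \<in> tree_sphere T r n. cmod (f v) powr enn2real p)) powr (1 / enn2real p))"

definition tree_norm ::
  "nat \<Rightarrow> ('a, 'b) pre_digraph \<Rightarrow> 'a \<Rightarrow> ennreal \<Rightarrow> ('a \<Rightarrow> complex) \<Rightarrow> ennreal" where
  "tree_norm q T r p f = (SUP n. ennreal (tree_mean q T r p n f))"

definition tree_space ::
  "nat \<Rightarrow> ('a, 'b) pre_digraph \<Rightarrow> 'a \<Rightarrow> ennreal \<Rightarrow> ('a \<Rightarrow> complex) set" where
  "tree_space q T r p = {f. tree_norm q T r p f < \<infinity>}"

end

theory Submission
  imports Defs
begin

text \<open>
  The distance of a tree is integer-valued, so its topology is discrete and compact sets are
  finite. At a vertex of the finite sphere of radius \<open>n\<close>, \<open>|h(v)|^p\<close> is at most the sum over the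
  sphere, so \<open>|h(v)|\<close> is bounded by a constant, depending only on \<open>n\<close>, times \<open>M_p(n, h)\<close>.
\<close>

section \<open>Walks and the uniqueness of paths in a tree\<close>

text \<open>Symmetry supplies an opposite for each arc; the induction reverses the tail and appends
  the opposite of the first arc. The vertex list is recorded because the length of the reversed walk
  and the vertices it avoids are read off from it.\<close>

lemma (in sym_digraph) awalk_reverse:
  assumes "awalk u p v"
  shows "\<exists>p'. awalk v p' u \<and> awalk_verts v p' = rev (awalk_verts u p)"
  using assms
proof (induction p arbitrary: u)
  case Nil
  then show ?case by (auto simp: awalk_Nil_iff intro!: exI[of _ "[]"])
next
  case (Cons e es)
  then have e: "e \<in> arcs G" "u = tail G e" and es: "awalk (head G e) es v"
    by (auto simp: awalk_Cons_iff)
  obtain p' where p': "awalk v p' (head G e)" "awalk_verts v p' = rev (awalk_verts (head G e) es)"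
    using Cons.IH[OF es] by blast
  have "(head G e, tail G e) \<in> arcs_ends G"
    using e graph_symmetric in_arcs_imp_in_arcs_ends by blast
  then obtain e' where e': "e' \<in> arcs G" "tail G e' = head G e" "head G e' = u"
    using e by auto
  have w: "awalk v (p' @ [e']) u"
    using e' p'(1) by (intro awalk_appendI[OF p'(1)]) (auto simp: awalk_simps)
  have "awalk_verts v (p' @ [e']) = rev (awalk_verts u (e # es))"
    using awalk_verts_append[OF w] p' e e' by simp
  with w show ?case by blast
qed

text \<open>Loop erasure keeps only arcs of the given walk. Hence shortening a walk that avoids a
  vertex yields a path that still avoids it.\<close>

lemma (in wf_digraph) set_awalk_verts_awalk_to_apath:
  assumes "awalk u p v"
  shows "set (awalk_verts u (awalk_to_apath p)) \<subseteq> set (awalk_verts u p)"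
proof -
  have "awalk u (awalk_to_apath p) v"
    by (rule awalkI_apath[OF apath_awalk_to_apath[OF assms]])
  then show ?thesis
    unfolding set_awalk_verts[OF assms] set_awalk_verts[OF \<open>awalk u (awalk_to_apath p) v\<close>] set_map
    using awalk_to_apath_subset[OF assms] by blast
qed

text \<open>
  Two paths leaving \<open>u\<close> through different neighbours and meeting again would close up,
  through a path that avoids \<open>u\<close>, to a cycle.
\<close>

lemma apath_unique:
  assumes T: "undirected_tree T"
    and "pre_digraph.apath T u p v" "pre_digraph.apath T u p' v"
  shows "p = p'"
proof -
  interpret sym_digraph T using T by (simp add: undirected_tree_def simple_graph_def)
  interpret nomulti_digraph T using T by (simp add: undirected_tree_def simple_graph_def)
  have no_cycle: "\<And>c. cycle c \<Longrightarrow> length c < 3"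
    using T by (auto simp: undirected_tree_def not_le)
  show ?thesis
    using assms(2,3)
  proof (induction p arbitrary: u p')
    case Nil
    \<comment> \<open>A path is empty exactly when its ends coincide.\<close>
    then show ?case using apath_ends by blast
  next
    case (Cons e es)
    then have "p' \<noteq> []" using apath_ends by blast
    then obtain e' es' where p': "p' = e' # es'" by (cases p') auto
    define a b where "a = head T e" and "b = head T e'"
    have e: "e \<in> arcs T" "tail T e = u" "apath a es v" "u \<notin> set (awalk_verts a es)"
      using Cons.prems(1) by (auto simp: apath_Cons_iff a_def)
    have e': "e' \<in> arcs T" "tail T e' = u" "apath b es' v" "u \<notin> set (awalk_verts b es')"
      using Cons.prems(2) by (auto simp: apath_Cons_iff b_def p')
    show ?case
    proof (cases "a = b")
      case True
      then have "e = e'"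
        using no_multi_arcs e e' by (simp add: arc_to_ends_def a_def b_def)
      moreover have "es = es'" using Cons.IH e(3) e'(3) True by simp
      ultimately show ?thesis using p' by simp
    next
      case False
      \<comment> \<open>Following \<open>es\<close> from \<open>a\<close> to \<open>v\<close> and
        then \<open>es'\<close> backwards to \<open>b\<close> never meets \<open>u\<close>; loop
        erasure turns this walk into the path \<open>s\<close>.\<close>
      obtain t where t: "awalk v t b" "awalk_verts v t = rev (awalk_verts b es')"
        using awalk_reverse awalkI_apath e'(3) by blast
      have w: "awalk a (es @ t) b" using e(3) t(1) by (auto simp: apath_def)
      define s where "s = awalk_to_apath (es @ t)"
      have s: "apath a s b" unfolding s_def by (rule apath_awalk_to_apath[OF w])
      have us: "u \<notin> set (awalk_verts a s)"
        using set_awalk_verts_awalk_to_apath[OF w] e(4) e'(4) t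
          set_awalk_verts_append[OF awalkI_apath[OF e(3)] t(1)] unfolding s_def by auto
      \<comment> \<open>With \<open>s\<close> nonempty, the cycle \<open>e # s @ [d]\<close> has at
        least three arcs, so it is not merely an edge traversed back and forth.\<close>
      have "s \<noteq> []" using s False by (auto simp: apath_Nil_iff)
      have "(b, u) \<in> arcs_ends T"
        using e' graph_symmetric in_arcs_imp_in_arcs_ends[of e'] unfolding b_def by blast
      then obtain d where d: "d \<in> arcs T" "tail T d = b" "head T d = u" by auto
      have sd: "awalk a (s @ [d]) u"
        using d awalkI_apath[OF s] by (intro awalk_appendI) (auto simp: awalk_simps)
      have "awalk_verts a (s @ [d]) = awalk_verts a s @ [u]"
        using awalk_verts_append[OF sd] awalkI_apath[OF s] d by simp
      then have "cycle (e # s @ [d])"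
        using sd e s us unfolding cycle_def
        by (intro exI[of _ u]) (auto simp: awalk_Cons_iff a_def apath_def)
      then show ?thesis using no_cycle \<open>s \<noteq> []\<close> by (cases s) force+
    qed
  qed
qed

section \<open>The tree distance, its metric and its topology\<close>

lemma tree_dist_apath:
  assumes "undirected_tree T" "pre_digraph.apath T u p v"
  shows "tree_dist T u v = length p"
proof -
  have "(THE p'. pre_digraph.apath T u p' v) = p"
    by (rule the_equality) (rule assms(2), rule apath_unique[OF assms(1) _ assms(2)])
  then show ?thesis by (simp only: tree_dist_def)
qed

lemma tree_apath_ex:
  assumes T: "undirected_tree T" and "u \<in> verts T" "v \<in> verts T"
  shows "\<exists>p. pre_digraph.apath T u p v"
proof -
  interpret sym_digraph T using T by (simp add: undirected_tree_def simple_graph_def)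
  have "strongly_connected T"
    using T by (intro symmetric_connected_imp_strongly_connected sym_arcs) (simp add: undirected_tree_def)
  then have "u \<rightarrow>\<^sup>*\<^bsub>T\<^esub> v"
    using assms(2,3) by (simp add: strongly_connected_def)
  then show ?thesis by (simp add: reachable_apath)
qed

text \<open>Shortening the walk to a path leaves distinct arcs, all taken from the walk. Together
  with \<open>tree_dist_awalk\<close> this makes the distance the least length of a walk, so the
  metric axioms follow by reversing and concatenating walks.\<close>

lemma tree_dist_awalk_le:
  assumes T: "undirected_tree T" and p: "pre_digraph.awalk T u p v"
  shows "tree_dist T u v \<le> length p"
proof -
  interpret sym_digraph T using T by (simp add: undirected_tree_def simple_graph_def)
  have ap: "apath u (awalk_to_apath p) v" using p by (rule apath_awalk_to_apath)
  have "length (awalk_to_apath p) = card (set (awalk_to_apath p))"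
    using ap distinct_verts_imp_distinct[of u _ v] by (auto simp: apath_def distinct_card)
  also have "\<dots> \<le> card (set p)"
    by (intro card_mono awalk_to_apath_subset[OF p]) simp
  also have "\<dots> \<le> length p" by (rule card_length)
  finally show ?thesis using tree_dist_apath[OF T ap] by simp
qed

lemma tree_dist_awalk:
  assumes T: "undirected_tree T" and uv: "u \<in> verts T" "v \<in> verts T"
  obtains p where "pre_digraph.awalk T u p v" "length p = tree_dist T u v"
proof -
  obtain p where p: "pre_digraph.apath T u p v" using tree_apath_ex[OF assms] by blast
  show thesis using that[of p] pre_digraph.awalkI_apath[OF p] tree_dist_apath[OF T p] by simp
qed

lemma tree_dist_commute:
  assumes T: "undirected_tree T"
  shows "tree_dist T u v = tree_dist T v u"
proof (cases "u \<in> verts T \<and> v \<in> verts T")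
  case True
  interpret sym_digraph T using T by (simp add: undirected_tree_def simple_graph_def)
  have le: "tree_dist T y x \<le> tree_dist T x y" if xy: "x \<in> verts T" "y \<in> verts T" for x y
  proof -
    obtain p where p: "awalk x p y" "length p = tree_dist T x y"
      using tree_dist_awalk[OF T xy] .
    obtain p' where p': "awalk y p' x" "awalk_verts y p' = rev (awalk_verts x p)"
      using awalk_reverse[OF p(1)] by blast
    then have "length p' = length p"
      by (metis length_awalk_verts length_rev nat.inject)
    then show ?thesis using tree_dist_awalk_le[OF T p'(1)] p(2) by simp
  qed
  show ?thesis using True le[of u v] le[of v u] by simp
next
  case False
  interpret sym_digraph T using T by (simp add: undirected_tree_def simple_graph_def)
  \<comment> \<open>\<open>Metric_space\<close> demands symmetry for all arguments, not only for
    vertices. Here neither direction has a path, so both distances are the length of the same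
    unspecified \<open>THE\<close>.\<close>
  have "\<not> apath u p v" "\<not> apath v p u" for p
    using False awalk_hd_in_verts awalk_last_in_verts by (auto simp: apath_def)
  then show ?thesis by (simp add: tree_dist_def)
qed

lemma Metric_space_tree_dist:
  assumes T: "undirected_tree T"
  shows "Metric_space (verts T) (\<lambda>u v. real (tree_dist T u v))"
proof -
  interpret sym_digraph T using T by (simp add: undirected_tree_def simple_graph_def)
  show ?thesis
  proof
    fix u v assume uv: "u \<in> verts T" "v \<in> verts T"
    obtain p where p: "awalk u p v" "length p = tree_dist T u v"
      using tree_dist_awalk[OF T uv] .
    show "real (tree_dist T u v) = 0 \<longleftrightarrow> u = v"
      using p uv tree_dist_awalk_le[OF T, of u "[]" v] by (auto simp: awalk_Nil_iff)
  next
    fix u v w assume u: "u \<in> verts T" and v: "v \<in> verts T" and w: "w \<in> verts T"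
    obtain p where p: "awalk u p v" "length p = tree_dist T u v"
      using tree_dist_awalk[OF T u v] .
    obtain p' where p': "awalk v p' w" "length p' = tree_dist T v w"
      using tree_dist_awalk[OF T v w] .
    show "real (tree_dist T u w) \<le> real (tree_dist T u v) + real (tree_dist T v w)"
      using tree_dist_awalk_le[OF T awalk_appendI[OF p(1) p'(1)]] p(2) p'(2) by simp
  qed (simp_all add: tree_dist_commute[OF T])
qed

lemma compactin_tree_topology:
  assumes T: "undirected_tree T"
  shows "compactin (tree_topology T) K \<longleftrightarrow> K \<subseteq> verts T \<and> finite K"
proof -
  interpret M: Metric_space "verts T" "\<lambda>u v. real (tree_dist T u v)"
    by (rule Metric_space_tree_dist[OF T])
  have "openin M.mtopology {u}" if u: "u \<in> verts T" for u
  proof -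
    \<comment> \<open>Distances are natural numbers, so a distance below 1 is 0.\<close>
    have "M.mball u 1 = {u}"
      using u M.zero by (auto simp: M.mball_def)
    then show ?thesis by (metis M.openin_mball)
  qed
  then have "tree_topology T = discrete_topology (verts T)"
    unfolding tree_topology_def by (metis M.topspace_mtopology discrete_topology_unique)
  then show ?thesis by (simp add: compactin_discrete_topology)
qed

section \<open>Finiteness of spheres\<close>

lemma (in wf_digraph) finite_awalk_ends:
  assumes "\<And>v. v \<in> verts G \<Longrightarrow> finite {w. v \<rightarrow>\<^bsub>G\<^esub> w}"
  shows "finite {v. \<exists>p. awalk u p v \<and> length p = n}"
proof (induction n arbitrary: u)
  case 0
  have "{v. \<exists>p. awalk u p v \<and> length p = 0} \<subseteq> {u}" by (auto simp: awalk_Nil_iff)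
  then show ?case using finite_subset by blast
next
  case (Suc n)
  show ?case
  proof (cases "u \<in> verts G")
    case True
    \<comment> \<open>Splitting off the first arc leaves a walk of length \<open>n\<close> from one
      of the finitely many neighbours of \<open>u\<close>.\<close>
    have "{v. \<exists>p. awalk u p v \<and> length p = Suc n}
        \<subseteq> (\<Union>w\<in>{w. u \<rightarrow>\<^bsub>G\<^esub> w}. {v. \<exists>p. awalk w p v \<and> length p = n})"
      by (force simp: length_Suc_conv awalk_Cons_iff dest: in_arcs_imp_in_arcs_ends)
    moreover have "finite (\<Union>w\<in>{w. u \<rightarrow>\<^bsub>G\<^esub> w}. {v. \<exists>p. awalk w p v \<and> length p = n})"
      using assms[OF True] Suc by (rule finite_UN_I)
    ultimately show ?thesis by (rule finite_subset)
  next
    case False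
    then have "{v. \<exists>p. awalk u p v \<and> length p = Suc n} = {}" using awalk_hd_in_verts by auto
    then show ?thesis by (simp only: finite.emptyI)
  qed
qed

lemma finite_tree_sphere:
  assumes "homogeneous_tree q T" "r \<in> verts T"
  shows "finite (tree_sphere T r n)"
proof -
  have T: "undirected_tree T" using assms by (simp add: homogeneous_tree_def)
  interpret sym_digraph T using T by (simp add: undirected_tree_def simple_graph_def)
  \<comment> \<open>An infinite set would have \<open>card\<close> 0, whereas homogeneity gives
    \<open>q + 1\<close>.\<close>
  have "finite {w. v \<rightarrow>\<^bsub>T\<^esub> w}" if "v \<in> verts T" for v
    using assms(1) that by (intro card_ge_0_finite) (simp add: homogeneous_tree_def)
  then have "finite {v. \<exists>p. awalk r p v \<and> length p = n}" by (rule finite_awalk_ends)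
  moreover have "tree_sphere T r n \<subseteq> {v. \<exists>p. awalk r p v \<and> length p = n}"
  proof
    fix v assume "v \<in> tree_sphere T r n"
    then have v: "v \<in> verts T" "tree_dist T r v = n" by (auto simp: tree_sphere_def)
    obtain p where "awalk r p v" "length p = tree_dist T r v"
      using tree_dist_awalk[OF T assms(2) v(1)] .
    then show "v \<in> {v. \<exists>p. awalk r p v \<and> length p = n}" using v by auto
  qed
  ultimately show ?thesis by (rule finite_subset[rotated])
qed

section \<open>Pointwise bounds by the means and by the norm\<close>

lemma cmod_le_tree_mean:
  assumes "1 \<le> q" and hom: "homogeneous_tree q T" and r: "r \<in> verts T" and "0 < p"
    and v: "v \<in> tree_sphere T r n"
  shows "\<exists>C\<ge>0. \<forall>h. cmod (h v) \<le> C * tree_mean q T r p n h"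
proof -
  have T: "undirected_tree T" using hom by (simp add: homogeneous_tree_def)
  interpret M: Metric_space "verts T" "\<lambda>u v. real (tree_dist T u v)"
    by (rule Metric_space_tree_dist[OF T])
  have fin: "finite (tree_sphere T r n)" by (rule finite_tree_sphere[OF hom r])
  consider "n = 0" | "n \<noteq> 0" "p = \<infinity>" | "n \<noteq> 0" "p \<noteq> \<infinity>" by blast
  then show ?thesis
  proof cases
    case 1
    then have "v = r" using v r M.zero[of r v] by (auto simp: tree_sphere_def)
    then show ?thesis using 1 by (intro exI[of _ 1]) (simp add: tree_mean_def)
  next
    case 2
    \<comment> \<open>Finiteness of the sphere makes \<open>Max\<close> a genuine upper
      bound.\<close>
    then show ?thesis using fin v by (intro exI[of _ 1]) (auto simp: tree_mean_def)
  next
    case 3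
    define a where "a = enn2real p"
    define N where "N = (real q + 1) * real q ^ (n - 1)"
    \<comment> \<open>\<open>enn2real\<close> sends infinity to 0, so positivity rests on both
      \<open>0 < p\<close> and \<open>p \<noteq> \<infinity>\<close>.\<close>
    have a: "a > 0" using 3 \<open>0 < p\<close> by (simp add: a_def enn2real_positive_iff less_top)
    have N: "N > 0" using \<open>1 \<le> q\<close> by (simp add: N_def)
    \<comment> \<open>Keeping one summand loses the factor \<open>1 / N\<close> of the mean; taking
      the root of order \<open>a\<close> turns the compensating \<open>N\<close> into
      \<open>N powr (1 / a)\<close>.\<close>
    have "cmod (h v) \<le> N powr (1 / a) * tree_mean q T r p n h" for h
    proof -
      define S where "S = (\<Sum>v \<in> tree_sphere T r n. cmod (h v) powr a)"
      have S: "cmod (h v) powr a \<le> S"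
        unfolding S_def using fin v by (intro member_le_sum) auto
      have "cmod (h v) = (cmod (h v) powr a) powr (1 / a)" using a by (simp add: powr_powr)
      also have "\<dots> \<le> S powr (1 / a)" using S a by (intro powr_mono2) auto
      also have "S = N * (1 / N * S)" using N by simp
      also have "(N * (1 / N * S)) powr (1 / a) = N powr (1 / a) * (1 / N * S) powr (1 / a)"
        by (rule powr_mult)
      also have "(1 / N * S) powr (1 / a) = tree_mean q T r p n h"
        using 3 by (simp add: tree_mean_def N_def S_def a_def)
      finally show ?thesis .
    qed
    then show ?thesis by (intro exI[of _ "N powr (1 / a)"]) simp
  qed
qed

text \<open>Each vertex lies on the sphere given by its own distance from the root, and the norm
  dominates the mean there. The constant is chosen before \<open>h\<close>, so it serves every
  member of a sequence at once.\<close>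

lemma cmod_le_tree_norm:
  assumes "1 \<le> q" "homogeneous_tree q T" "r \<in> verts T" "0 < p" "v \<in> verts T"
  shows "\<exists>C\<ge>0. \<forall>h. ennreal (cmod (h v)) \<le> ennreal C * tree_norm q T r p h"
proof -
  define n where "n = tree_dist T r v"
  have "v \<in> tree_sphere T r n" using assms(5) by (simp add: n_def tree_sphere_def)
  then obtain C where C: "C \<ge> 0" "\<And>h. cmod (h v) \<le> C * tree_mean q T r p n h"
    using cmod_le_tree_mean[OF assms(1-4)] by blast
  have "ennreal (cmod (h v)) \<le> ennreal C * tree_norm q T r p h" for h
  proof -
    have "ennreal (cmod (h v)) \<le> ennreal C * ennreal (tree_mean q T r p n h)"
      using C by (metis ennreal_leI ennreal_mult')
    also have "\<dots> \<le> ennreal C * tree_norm q T r p h"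
      unfolding tree_norm_def by (intro mult_left_mono SUP_upper) auto
    finally show ?thesis .
  qed
  with C(1) show ?thesis by blast
qed

section \<open>Uniform convergence on compact sets\<close>

theorem proposition1:
  fixes q :: nat and T :: "('a, 'b) pre_digraph" and r :: 'a and p :: ennreal
    and f :: "nat \<Rightarrow> 'a \<Rightarrow> complex" and g :: "'a \<Rightarrow> complex"
  assumes "1 \<le> q"
    and "homogeneous_tree q T"
    and "infinite (verts T)"
    and "r \<in> verts T"
    and "0 < p"
    and "g \<in> tree_space q T r p"
    and "\<And>n. 1 \<le> n \<Longrightarrow> f n \<in> tree_space q T r p"
    and "(\<lambda>n. tree_norm q T r p (\<lambda>v. f n v - g v)) \<longlonglongrightarrow> 0"
  shows "\<forall>K. compactin (tree_topology T) K \<longrightarrow>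
           (\<lambda>n. SUP v\<in>K. ennreal (cmod (f n v - g v))) \<longlonglongrightarrow> 0"
proof (intro allI impI)
  fix K assume "compactin (tree_topology T) K"
  then have K: "K \<subseteq> verts T" "finite K"
    using compactin_tree_topology assms(2) by (auto simp: homogeneous_tree_def)
  let ?norm = "\<lambda>n. tree_norm q T r p (\<lambda>v. f n v - g v)"
  obtain C where C: "\<And>v h. v \<in> verts T \<Longrightarrow>
      ennreal (cmod (h v)) \<le> ennreal (C v) * tree_norm q T r p h"
    using cmod_le_tree_norm[OF assms(1,2,4,5)] by metis
  \<comment> \<open>Bounding the supremum by a sum over the finite set \<open>K\<close> reduces the
    claim to convergence at each vertex; for empty \<open>K\<close> both sides are 0.\<close>
  have le: "(SUP v\<in>K. ennreal (cmod (f n v - g v))) \<le> (\<Sum>v\<in>K. ennreal (C v) * ?norm n)" for n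
  proof (rule SUP_least)
    fix v assume v: "v \<in> K"
    have "ennreal (cmod (f n v - g v)) \<le> ennreal (C v) * ?norm n"
      using C[of v "\<lambda>v. f n v - g v"] v K by auto
    also have "\<dots> \<le> (\<Sum>v\<in>K. ennreal (C v) * ?norm n)"
      using v K by (intro member_le_sum) auto
    finally show "ennreal (cmod (f n v - g v)) \<le> (\<Sum>v\<in>K. ennreal (C v) * ?norm n)" .
  qed
  \<comment> \<open>The factor \<open>ennreal (C v)\<close> is finite, so multiplication by it
    preserves the limit.\<close>
  have "(\<lambda>n. ennreal (C v) * ?norm n) \<longlonglongrightarrow> ennreal (C v) * 0" for v
    by (intro ennreal_tendsto_cmult assms(8)) simp
  then have "(\<lambda>n. \<Sum>v\<in>K. ennreal (C v) * ?norm n) \<longlonglongrightarrow> (\<Sum>v\<in>K. ennreal (C v) * 0)"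
    by (intro tendsto_sum)
  then have "(\<lambda>n. \<Sum>v\<in>K. ennreal (C v) * ?norm n) \<longlonglongrightarrow> 0" by simp
  then show "(\<lambda>n. SUP v\<in>K. ennreal (cmod (f n v - g v))) \<longlonglongrightarrow> 0"
    by (rule tendsto_sandwich[OF always_eventually always_eventually tendsto_const, rotated 2])
      (intro allI zero_le le)+
qed

end
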